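(* Let $c$ be the constraint function of a one-dimensional kinetically constrained lattice gas (KCLG), and let $q_c$ be its critical parameter. For a set $A\subset\mathbb{Z}$ let $\mathbf{1}_A\in\{0,1\}^{\mathbb{Z}}$ be the configuration which is filled (equal to $1$) on $A$ and empty (equal to $0$) elsewhere. Then: (1) If $c(-1,0,\mathbf{1}_{(-\infty,-1]})\neq 0$ and $c(-1,0,\mathbf{1}_{[0,\infty)})\neq 0$, then $q_c=0$; moreover in this case the model is noncooperative. (2) If $c(-1,0,\mathbf{1}_{(-\infty,-1]})=0$ and $c(-1,0,\mathbf{1}_{[0,\infty)})=0$, then $q_c=1$ (such models are called blocked). (3) If exactly one of $c(-1,0,\mathbf{1}_{(-\infty,-1]})$ and $c(-1,0,\mathbf{1}_{[0,\infty)})$ is nonzero, then $0<q_c<1$ (such models are called one-sided).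
   Context: Let $\Omega=\{0,1\}^{\mathbb{Z}}$ ($0$ = empty site/vacancy, $1$ = filled site/particle). All intervals are intervals of integers. For $\eta\in\Omega$, $\eta^{xy}=\eta^{x,y}$ is the configuration obtained from $\eta$ by exchanging the values at $x$ and $y$, and $\tau_z$ is translation by $z$: $(\tau_z\eta)(x)=\eta(x-z)$. A KCLG is the Markov process on $\Omega$ with generator $\mathcal{L}f(\eta)=\frac12\sum_{x,y\in\mathbb{Z}}c(x,y,\eta)(f(\eta^{xy})-f(\eta))$, where the constraint function $c:\mathbb{Z}\times\mathbb{Z}\times\Omega\to[0,\infty)$ satisfies: (i) nearest-neighbor jumps: $c(x,y,\eta)=0$ if $|x-y|\neq1$, and $c(x,y,\eta)=c(y,x,\eta)$; (ii) translation invariance: $c(x,y,\eta)=c(x+z,y+z,\tau_z\eta)$ for all $x,y,z$; (iii) $c(x,y,\eta)$ does not depend on the occupations $\eta(x),\eta(y)$; in particular $c(x,y,\eta)=c(x,y,\eta^{xy})$; (iv) finite range: there is an integer $r>0$ such that $c(x,y,\eta)$ depends only on the restriction of $\eta$ to $x+[-r,r]$; (v) monotonicity: if $\eta(x)\le\omega(x)$ for all $x$, then $c(x,y,\eta)\ge c(x,y,\omega)$ for all $x,y$. Two configurations are connected, $\eta\longleftrightarrow\eta'$, if there is a finite sequence $\eta_0=\eta,\eta_1,\dots,\eta_n=\eta'$ such that for each $i$, $\eta_{i+1}=\eta_i^{x,y}$ for some $x,y$ with $c(x,y,\eta_i)\ne0$. For $q\in(0,1)$, $\mu_q$ is the product over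 sites of $\mathbb{Z}$ of Bernoulli measures of parameter $1-q$ (so each site is empty with probability $q$). The KCLG is ergodic at $q$ if $\mu_q$-almost surely $\eta\longleftrightarrow\eta^{0,1}$. The critical parameter is $q_c=\inf\{q\in(0,1):\text{the process is ergodic at }q\}=\sup\{q\in(0,1):\text{the process is not ergodic at }q\}$ (the two agree by monotonicity; convention: $\inf\emptyset=1$, $\sup\emptyset=0$). A KCLG is noncooperative if it has a mobile cluster, i.e. a finite nonempty set $A\subset\mathbb{Z}$ such that for every $x_0\in\mathbb{Z}$, every $\eta\in\Omega$ which is empty on $x_0+A$, and each $s\in\{+1,-1\}$, there is $\eta'\longleftrightarrow\eta$ which is empty on $x_0+s+A$. *)

theory Defs
  imports "HOL-Probability.Probability"
begin

text \<open>
  Configurations on the integers. \<open>True\<close> is a filled site (value 1) and \<open>False\<close> an empty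
  site (value 0), so the pointwise order on \<open>config\<close> is the usual order on 0-1 valued
  configurations.
\<close>

type_synonym config = "int \<Rightarrow> bool"

definition exch :: "int \<Rightarrow> int \<Rightarrow> config \<Rightarrow> config" where
  "exch x y \<eta> = \<eta>(x := \<eta> y, y := \<eta> x)"

definition shift :: "int \<Rightarrow> config \<Rightarrow> config" where
  "shift z \<eta> = (\<lambda>x. \<eta> (x - z))"

definition filled_on :: "int set \<Rightarrow> config" where
  "filled_on A = (\<lambda>x. x \<in> A)"

definition empty_on :: "config \<Rightarrow> int set \<Rightarrow> bool" where
  "empty_on \<eta> A \<longleftrightarrow> (\<forall>x\<in>A. \<not> \<eta> x)"

text \<open>
  The constraint function of a one-dimensional kinetically constrained lattice gas:
  \<open>c x y \<eta>\<close> is the rate at which the occupations of \<open>x\<close> and \<open>y\<close> are exchanged.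
\<close>

locale kclg =
  fixes c :: "int \<Rightarrow> int \<Rightarrow> config \<Rightarrow> real"
  assumes nonneg: "c x y \<eta> \<ge> 0"
    and nearest_neighbour: "\<bar>x - y\<bar> \<noteq> 1 \<Longrightarrow> c x y \<eta> = 0"
    and symmetric: "c x y \<eta> = c y x \<eta>"
    and translation_invariant: "c x y \<eta> = c (x + z) (y + z) (shift z \<eta>)"
    and independent_of_endpoints:
      "(\<And>z. z \<noteq> x \<Longrightarrow> z \<noteq> y \<Longrightarrow> \<eta> z = \<omega> z) \<Longrightarrow> c x y \<eta> = c x y \<omega>"
    and finite_range:
      "\<exists>r>0. \<forall>x y \<eta> \<omega>. (\<forall>z\<in>{x - r..x + r}. \<eta> z = \<omega> z) \<longrightarrow> c x y \<eta> = c x y \<omega>"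
    and monotone: "\<eta> \<le> \<omega> \<Longrightarrow> c x y \<eta> \<ge> c x y \<omega>"

definition connected_configs ::
    "(int \<Rightarrow> int \<Rightarrow> config \<Rightarrow> real) \<Rightarrow> config \<Rightarrow> config \<Rightarrow> bool" where
  "connected_configs c = (\<lambda>\<eta> \<omega>. \<exists>x y. c x y \<eta> \<noteq> 0 \<and> \<omega> = exch x y \<eta>)\<^sup>*\<^sup>*"

text \<open>Each site is empty with probability \<open>q\<close>, independently.\<close>

definition site_measure :: "real \<Rightarrow> config measure" where
  "site_measure q = PiM UNIV (\<lambda>_. measure_pmf (bernoulli_pmf (1 - q)))"

definition ergodic_at :: "(int \<Rightarrow> int \<Rightarrow> config \<Rightarrow> real) \<Rightarrow> real \<Rightarrow> bool" where
  "ergodic_at c q \<longleftrightarrow> (AE \<eta> in site_measure q. connected_configs c \<eta> (exch 0 1 \<eta>))"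

text \<open>The case distinction implements the convention that the infimum of the empty set is 1.\<close>

definition critical_parameter :: "(int \<Rightarrow> int \<Rightarrow> config \<Rightarrow> real) \<Rightarrow> real" where
  "critical_parameter c =
     (let E = {q \<in> {0<..<1}. ergodic_at c q} in if E = {} then 1 else Inf E)"

definition mobile_cluster ::
    "(int \<Rightarrow> int \<Rightarrow> config \<Rightarrow> real) \<Rightarrow> int set \<Rightarrow> bool" where
  "mobile_cluster c A \<longleftrightarrow> finite A \<and> A \<noteq> {} \<and>
     (\<forall>x\<^sub>0 \<eta>. \<forall>s\<in>{1, -1}. empty_on \<eta> ((+) x\<^sub>0 ` A) \<longrightarrow>
        (\<exists>\<eta>'. connected_configs c \<eta>' \<eta> \<and> empty_on \<eta>' ((+) (x\<^sub>0 + s) ` A)))"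

definition noncooperative :: "(int \<Rightarrow> int \<Rightarrow> config \<Rightarrow> real) \<Rightarrow> bool" where
  "noncooperative c \<longleftrightarrow> (\<exists>A. mobile_cluster c A)"

end

theory Submission
  imports Defs
begin

text \<open>
  By monotonicity and finite range, \<open>c (-1) 0 (filled_on {..-1}) \<noteq> 0\<close> means that \<open>r\<close> vacancies to
  the right of a bond enable it, and \<open>c (-1) 0 (filled_on {..-1}) = 0\<close> means that \<open>r\<close> particles to
  the left of a bond block it; symmetrically for \<open>filled_on {0..}\<close>.

  If vacancies on either side enable a bond, a long empty interval is mobile, and almost surely there
  is one. If particles on either side block a bond, a long filled interval never breaks. In the
  one-sided case, at high vacancy density the random walk that gains \<open>1\<close> at a vacancy and loses \<open>r\<close>
  at a particle eventually reaches \<open>r\<close>, and then particles can be pushed right until the sites next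
  to \<open>(0, 1)\<close> are empty; at low vacancy density, with positive probability every
  \<open>{1..n}\<close> has fewer than \<open>n / (r + 1)\<close> vacancies, a property that the dynamics preserves.
\<close>

section \<open>Enabled and blocked bonds\<close>

lemma exch_exch [simp]: "exch x y (exch x y \<eta>) = \<eta>"
  by (auto simp: exch_def)

text \<open>The range is fixed as a natural number because it later serves as a length, a weight and
  an exponent.\<close>

locale kclg_range = kclg c for c :: "int \<Rightarrow> int \<Rightarrow> config \<Rightarrow> real" +
  fixes r :: nat
  assumes r_pos: "0 < r"
    and range: "(\<And>z. x - int r \<le> z \<Longrightarrow> z \<le> x + int r \<Longrightarrow> \<eta> z = \<omega> z) \<Longrightarrow> c x y \<eta> = c x y \<omega>"

lemma (in kclg) kclg_range_exists: "\<exists>r. kclg_range c r"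
proof -
  obtain r :: int where "r > 0"
    and r: "\<And>x y \<eta> \<omega>. \<forall>z\<in>{x - r..x + r}. \<eta> z = \<omega> z \<Longrightarrow> c x y \<eta> = c x y \<omega>"
    using finite_range by blast
  then have "kclg_range c (nat r)"
    by unfold_locales auto
  then show ?thesis ..
qed

section \<open>Reversibility of moves and reduction to a single bond\<close>

context kclg
begin

lemma c_exch: "c x y (exch x y \<eta>) = c x y \<eta>"
  by (rule independent_of_endpoints) (auto simp: exch_def)

lemma connected_step: "c x y \<eta> \<noteq> 0 \<Longrightarrow> connected_configs c \<eta> (exch x y \<eta>)"
  unfolding connected_configs_def by (rule r_into_rtranclp) blast

lemma connected_trans:
  "connected_configs c \<eta> \<omega> \<Longrightarrow> connected_configs c \<omega> \<zeta> \<Longrightarrow> connected_configs c \<eta> \<zeta>"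
  unfolding connected_configs_def by (rule rtranclp_trans)

text \<open>An exchange undoes itself, and its rate is the same afterwards because it ignores the
  two exchanged sites.\<close>

lemma connected_sym: "connected_configs c \<eta> \<omega> \<Longrightarrow> connected_configs c \<omega> \<eta>"
  unfolding connected_configs_def
proof (induction rule: rtranclp_induct)
  case (step \<omega> \<zeta>)
  then have "\<exists>x y. c x y \<zeta> \<noteq> 0 \<and> \<omega> = exch x y \<zeta>"
    by (metis c_exch exch_exch)
  then show ?case
    using step.IH by (rule converse_rtranclp_into_rtranclp)
qed auto

text \<open>Since rates are symmetric and vanish off nearest neighbours, every allowed exchange is
  one along a bond \<open>(x, x + 1)\<close>, so an invariant has to be checked only there.\<close>

lemma connected_invariant:
  assumes "connected_configs c \<eta> \<omega>" and "P \<eta>"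
    and step: "\<And>x \<zeta>. P \<zeta> \<Longrightarrow> c x (x + 1) \<zeta> \<noteq> 0 \<Longrightarrow> P (exch x (x + 1) \<zeta>)"
  shows "P \<omega>"
  using assms(1) unfolding connected_configs_def
proof (induction rule: rtranclp_induct)
  case (step \<zeta> \<zeta>')
  then obtain x y where xy: "c x y \<zeta> \<noteq> 0" "\<zeta>' = exch x y \<zeta>"
    by blast
  then consider "y = x + 1" | "x = y + 1"
    using nearest_neighbour[of x y \<zeta>] by linarith
  then show ?case
  proof cases
    case 1
    then show ?thesis using xy step.IH assms(3) by simp
  next
    case 2
    then have "\<zeta>' = exch y (y + 1) \<zeta>"
      using xy by (auto simp: exch_def fun_eq_iff)
    moreover have "c y (y + 1) \<zeta> \<noteq> 0"
      using xy 2 symmetric[of x y] by simp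
    ultimately show ?thesis using step.IH assms(3) by simp
  qed
qed (use assms(2) in simp)

lemma c_shift_origin: "c x (x + 1) \<eta> = c (- 1) 0 (\<lambda>z. \<eta> (z + 1 + x))"
proof -
  have "c x (x + 1) \<eta> = c (x + (-1 - x)) (x + 1 + (-1 - x)) (shift (-1 - x) \<eta>)"
    by (rule translation_invariant)
  also have "shift (-1 - x) \<eta> = (\<lambda>z. \<eta> (z + 1 + x))"
    by (simp add: shift_def algebra_simps)
  finally show ?thesis by (simp add: add.commute)
qed

end

section \<open>Comparison of rates with the two half-line configurations\<close>

context kclg_range
begin

text \<open>Monotonicity compares whole configurations, whereas here the order is known only near
  the bond and off its endpoints; a hybrid configuration bridges the gap.\<close>

lemma c_mono_local:
  assumes "\<And>z. - 1 - int r \<le> z \<Longrightarrow> z \<le> int r \<Longrightarrow> z \<noteq> - 1 \<Longrightarrow> z \<noteq> 0 \<Longrightarrow> \<eta> (z + 1 + x) \<Longrightarrow> \<omega> z"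
  shows "c (- 1) 0 \<omega> \<le> c x (x + 1) \<eta>"
proof -
  define \<zeta> where "\<zeta> = (\<lambda>z. \<eta> (z + 1 + x))"
  \<comment> \<open>The hybrid copies \<open>\<omega>\<close> at the endpoints and outside the
    window, so it lies below \<open>\<omega>\<close> everywhere; endpoints and far sites are then
    replaced without changing the rate.\<close>
  define \<zeta>' where
    "\<zeta>' = (\<lambda>z. if z = - 1 \<or> z = 0 \<or> z < - 1 - int r \<or> z > int r then \<omega> z else \<zeta> z)"
  have "c (- 1) 0 \<omega> \<le> c (- 1) 0 \<zeta>'"
    by (rule monotone) (auto simp: \<zeta>'_def \<zeta>_def le_fun_def assms)
  also have "\<dots> = c (- 1) 0 (\<zeta>'(- 1 := \<zeta> (- 1), 0 := \<zeta> 0))"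
    by (rule independent_of_endpoints) auto
  also have "\<dots> = c (- 1) 0 \<zeta>"
    by (rule range) (auto simp: \<zeta>'_def)
  finally show ?thesis
    by (simp add: c_shift_origin \<zeta>_def)
qed

lemma c_antimono_local:
  assumes "\<And>z. - 1 - int r \<le> z \<Longrightarrow> z \<le> int r \<Longrightarrow> z \<noteq> - 1 \<Longrightarrow> z \<noteq> 0 \<Longrightarrow> \<omega> z \<Longrightarrow> \<eta> (z + 1 + x)"
  shows "c x (x + 1) \<eta> \<le> c (- 1) 0 \<omega>"
proof -
  define \<zeta> where "\<zeta> = (\<lambda>z. \<eta> (z + 1 + x))"
  define \<zeta>' where
    "\<zeta>' = (\<lambda>z. if z = - 1 \<or> z = 0 \<or> z < - 1 - int r \<or> z > int r then \<omega> z else \<zeta> z)"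
  have "c x (x + 1) \<eta> = c (- 1) 0 \<zeta>"
    by (simp add: c_shift_origin \<zeta>_def)
  also have "\<dots> = c (- 1) 0 (\<zeta>'(- 1 := \<zeta> (- 1), 0 := \<zeta> 0))"
    by (rule range) (auto simp: \<zeta>'_def)
  also have "\<dots> = c (- 1) 0 \<zeta>'"
    by (rule independent_of_endpoints) auto
  also have "\<dots> \<le> c (- 1) 0 \<omega>"
    by (rule monotone) (auto simp: \<zeta>'_def \<zeta>_def le_fun_def assms)
  finally show ?thesis .
qed

text \<open>The half-line configuration is the worst case: all sites left of the bond are filled, so
  near the bond and off its endpoints \<open>\<eta>\<close> lies below it.\<close>

lemma enabled_right:
  assumes "c (- 1) 0 (filled_on {..- 1}) \<noteq> 0" and "empty_on \<eta> {x + 2..x + 1 + int r}"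
  shows "c x (x + 1) \<eta> \<noteq> 0"
proof -
  have "c (- 1) 0 (filled_on {..- 1}) \<le> c x (x + 1) \<eta>"
    using assms(2) by (intro c_mono_local) (force simp: filled_on_def empty_on_def)
  then show ?thesis
    using assms(1) nonneg[of "- 1" 0 "filled_on {..- 1}"] by linarith
qed

lemma enabled_left:
  assumes "c (- 1) 0 (filled_on {0..}) \<noteq> 0" and "empty_on \<eta> {x - int r..x - 1}"
  shows "c x (x + 1) \<eta> \<noteq> 0"
proof -
  have "c (- 1) 0 (filled_on {0..}) \<le> c x (x + 1) \<eta>"
    using assms(2) by (intro c_mono_local) (force simp: filled_on_def empty_on_def)
  then show ?thesis
    using assms(1) nonneg[of "- 1" 0 "filled_on {0..}"] by linarith
qed

lemma blocked_right:
  assumes "c (- 1) 0 (filled_on {0..}) = 0" and "\<And>z. x + 2 \<le> z \<Longrightarrow> z \<le> x + 1 + int r \<Longrightarrow> \<eta> z"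
  shows "c x (x + 1) \<eta> = 0"
proof -
  have "c x (x + 1) \<eta> \<le> c (- 1) 0 (filled_on {0..})"
    using assms(2) by (intro c_antimono_local) (auto simp: filled_on_def)
  then show ?thesis
    using assms(1) nonneg[of x "x + 1" \<eta>] by linarith
qed

lemma blocked_left:
  assumes "c (- 1) 0 (filled_on {..- 1}) = 0" and "\<And>z. x - int r \<le> z \<Longrightarrow> z \<le> x - 1 \<Longrightarrow> \<eta> z"
  shows "c x (x + 1) \<eta> = 0"
proof -
  have "c x (x + 1) \<eta> \<le> c (- 1) 0 (filled_on {..- 1})"
    using assms(2) by (intro c_antimono_local) (auto simp: filled_on_def)
  then show ?thesis
    using assms(1) nonneg[of x "x + 1" \<eta>] by linarith
qed

end

section \<open>Moves inside a half-line\<close>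

context kclg
begin

text \<open>Quantifying over all \<open>\<zeta>\<close> that agree with \<open>\<eta>\<close> on
  \<open>[a, \<infinity>)\<close> ensures that the move stays allowed whatever is changed to the
  left of \<open>a\<close>.\<close>

definition half_line_step :: "int \<Rightarrow> config \<Rightarrow> config \<Rightarrow> bool" where
  "half_line_step a \<eta> \<omega> \<longleftrightarrow> (\<exists>x\<ge>a. \<omega> = exch x (x + 1) \<eta> \<and>
     (\<forall>\<zeta>. (\<forall>z\<ge>a. \<zeta> z = \<eta> z) \<longrightarrow> c x (x + 1) \<zeta> \<noteq> 0))"

abbreviation half_line_steps :: "int \<Rightarrow> config \<Rightarrow> config \<Rightarrow> bool" where
  "half_line_steps a \<equiv> (half_line_step a)\<^sup>*\<^sup>*"

lemma half_line_steps_connected: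
  "half_line_steps a \<eta> \<omega> \<Longrightarrow> connected_configs c \<eta> \<omega>"
proof (induction rule: rtranclp_induct)
  case base
  then show ?case by (simp add: connected_configs_def)
next
  case (step \<omega> \<zeta>)
  from step.hyps(2) have "connected_configs c \<omega> \<zeta>"
    unfolding half_line_step_def by (blast intro: connected_step)
  then show ?case
    using step.IH connected_trans by blast
qed

lemma half_line_steps_mono:
  assumes "a \<le> b" and "half_line_steps b \<eta> \<omega>"
  shows "half_line_steps a \<eta> \<omega>"
proof -
  have "half_line_step b \<le> half_line_step a"
  proof (rule predicate2I)
    fix \<zeta> \<xi>
    assume "half_line_step b \<zeta> \<xi>"
    then obtain x where "b \<le> x" "\<xi> = exch x (x + 1) \<zeta>"
      "\<And>\<sigma>. \<forall>z\<ge>b. \<sigma> z = \<zeta> z \<Longrightarrow> c x (x + 1) \<sigma> \<noteq> 0"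
      unfolding half_line_step_def by blast
    then show "half_line_step a \<zeta> \<xi>"
      unfolding half_line_step_def using assms(1) by (intro exI[of _ x]) auto
  qed
  then show ?thesis
    using assms(2) by (rule predicate2D[OF rtranclp_mono])
qed

lemma half_line_steps_outside:
  "half_line_steps a \<eta> \<omega> \<Longrightarrow> z < a \<Longrightarrow> \<omega> z = \<eta> z"
  by (induction rule: rtranclp_induct) (auto simp: half_line_step_def exch_def)

text \<open>Sites left of \<open>a\<close> neither influence these moves nor are touched by them, so
  the same sequence runs from the exchanged configuration. This lets moves be undone after an
  exchange at the origin.\<close>

lemma half_line_steps_exch_outside:
  assumes "half_line_steps a \<eta> \<omega>" and "x < a" "y < a"
  shows "half_line_steps a (exch x y \<eta>) (exch x y \<omega>)"
  using assms(1)
proof (induction rule: rtranclp_induct)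
  case (step \<omega> \<zeta>)
  then obtain u where u: "u \<ge> a" "\<zeta> = exch u (u + 1) \<omega>"
    and c: "\<And>\<xi>. \<forall>z\<ge>a. \<xi> z = \<omega> z \<Longrightarrow> c u (u + 1) \<xi> \<noteq> 0"
    unfolding half_line_step_def by blast
  have "exch x y \<zeta> = exch u (u + 1) (exch x y \<omega>)"
    using u assms by (auto simp: exch_def fun_eq_iff)
  moreover have "\<forall>z\<ge>a. exch x y \<omega> z = \<omega> z"
    using assms by (auto simp: exch_def)
  ultimately have "half_line_step a (exch x y \<omega>) (exch x y \<zeta>)"
    unfolding half_line_step_def using u c by (intro exI[of _ u]) auto
  then show ?case
    using step.IH by simp
qed simp

end

context kclg_range
begin

text \<open>Carry out moves in \<open>[2, \<infinity>)\<close> that unblock the bond \<open>(0, 1)\<close>, exchange, and undo the moves.\<close>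

lemma exch_origin_connected:
  assumes "c (- 1) 0 (filled_on {..- 1}) \<noteq> 0"
    and steps: "half_line_steps 2 \<eta> \<omega>" and "empty_on \<omega> {2..1 + int r}"
  shows "connected_configs c \<eta> (exch 0 1 \<eta>)"
proof -
  have "c 0 (0 + 1) \<omega> \<noteq> 0"
    by (rule enabled_right) (use assms in simp_all)
  then have "connected_configs c \<omega> (exch 0 1 \<omega>)"
    using connected_step[of 0 1 \<omega>] by simp
  moreover have "connected_configs c (exch 0 1 \<eta>) (exch 0 1 \<omega>)"
    using half_line_steps_exch_outside[OF steps, of 0 1] half_line_steps_connected by simp
  ultimately show ?thesis
    using half_line_steps_connected[OF steps] connected_trans connected_sym by blast
qed

lemma half_line_step_right:
  assumes "c (- 1) 0 (filled_on {..- 1}) \<noteq> 0"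
    and "a \<le> x" and "empty_on \<eta> {x + 2..x + 1 + int r}"
  shows "half_line_step a \<eta> (exch x (x + 1) \<eta>)"
  unfolding half_line_step_def using assms(2,3)
  by (intro exI[of _ x] conjI allI impI enabled_right[OF assms(1)]) (auto simp: empty_on_def)

text \<open>The enabling vacancies reach down to \<open>x - int r\<close>, which has to lie in the
  half-line; hence \<open>a + int r \<le> x\<close>.\<close>

lemma half_line_step_left:
  assumes "c (- 1) 0 (filled_on {0..}) \<noteq> 0"
    and "a + int r \<le> x" and "empty_on \<eta> {x - int r..x - 1}"
  shows "half_line_step a \<eta> (exch x (x + 1) \<eta>)"
  unfolding half_line_step_def using assms(2,3)
  by (intro exI[of _ x] conjI allI impI enabled_left[OF assms(1)]) (auto simp: empty_on_def)

section \<open>Draining a region of low particle density\<close>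

text \<open>At each of the \<open>k\<close> steps the bond ahead is enabled by the \<open>r\<close>
  vacancies behind it on the right; the last \<open>r\<close> sites of the stretch are kept for
  this.\<close>

lemma push_particle_right:
  assumes R: "c (- 1) 0 (filled_on {..- 1}) \<noteq> 0"
    and "empty_on \<eta> ({a..a + int k + int r} - {a})"
  shows "\<exists>\<omega>. half_line_steps a \<eta> \<omega> \<and> empty_on \<omega> ({a..a + int k + int r} - {a + int k})"
proof -
  let ?e = "a + int k + int r"
  have "\<exists>\<omega>. half_line_steps a \<eta> \<omega> \<and> empty_on \<omega> ({a..?e} - {a + int j})" if "j \<le> k" for j
    using that
  proof (induction j)
    case 0
    then show ?case using assms(2) by auto
  next
    case (Suc j)
    then obtain \<omega> where \<omega>: "half_line_steps a \<eta> \<omega>" "empty_on \<omega> ({a..?e} - {a + int j})"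
      by auto
    let ?\<zeta> = "exch (a + int j) (a + int j + 1) \<omega>"
    have "half_line_step a \<omega> ?\<zeta>"
      by (rule half_line_step_right[OF R]) (use \<omega>(2) Suc.prems in \<open>auto simp: empty_on_def\<close>)
    moreover have "empty_on ?\<zeta> ({a..?e} - {a + int (Suc j)})"
      using \<omega>(2) Suc.prems by (auto simp: empty_on_def exch_def)
    ultimately show ?case
      using \<omega>(1) by (meson rtranclp.rtrancl_into_rtrancl)
  qed
  then show ?thesis by blast
qed

text \<open>The change in length of the usable empty stretch when site \<open>i\<close> is added on
  its left.\<close>

definition weight :: "config \<Rightarrow> int \<Rightarrow> int" where
  "weight \<eta> i = (if \<eta> i then - int r else 1)"

text \<open>
  Processing the sites from right to left, a vacancy joins the empty stretch on its right, and a
  particle is pushed through that stretch, using up the \<open>r\<close> vacancies that are left on its right.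
\<close>

lemma drain:
  assumes R: "c (- 1) 0 (filled_on {..- 1}) \<noteq> 0"
    and "a \<le> b + 1"
    and "\<And>k. a \<le> k \<Longrightarrow> k \<le> b \<Longrightarrow> 0 \<le> sum (weight \<eta>) {k..b}"
  shows "\<exists>\<omega>. half_line_steps a \<eta> \<omega> \<and> empty_on \<omega> {a..<a + sum (weight \<eta>) {a..b}}"
  using assms(2,3)
proof (induction a rule: int_le_induct)
  case base
  then show ?case by (auto simp: empty_on_def)
next
  case (step a)
  let ?s = "sum (weight \<eta>) {a..b}"
  obtain \<omega> where \<omega>: "half_line_steps a \<eta> \<omega>" "empty_on \<omega> {a..<a + ?s}"
    using step by force
  have steps: "half_line_steps (a - 1) \<eta> \<omega>"
    using half_line_steps_mono[OF _ \<omega>(1)] by simp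
  have same: "\<omega> (a - 1) = \<eta> (a - 1)"
    using half_line_steps_outside[OF \<omega>(1)] by simp
  have "{a - 1..b} = insert (a - 1) {a..b}"
    using step.hyps by auto
  then have sum: "sum (weight \<eta>) {a - 1..b} = weight \<eta> (a - 1) + ?s"
    by simp
  show ?case
  proof (cases "\<eta> (a - 1)")
    case False
    then have "weight \<eta> (a - 1) = 1"
      by (simp add: weight_def)
    then have "{a - 1..<a - 1 + sum (weight \<eta>) {a - 1..b}} \<subseteq> insert (a - 1) {a..<a + ?s}"
      unfolding sum by auto
    then have "empty_on \<omega> {a - 1..<a - 1 + sum (weight \<eta>) {a - 1..b}}"
      using \<omega>(2) same False by (auto simp: empty_on_def)
    then show ?thesis using steps by blast
  next
    case True
    have "0 \<le> sum (weight \<eta>) {a - 1..b}"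
      using step by simp
    then have "int r \<le> ?s"
      using sum True by (simp add: weight_def)
    \<comment> \<open>This number of steps leaves exactly \<open>r\<close> vacancies beyond the
      particle; the \<open>k\<close> sites before it form the new stretch.\<close>
    define k where "k = nat (?s - int r)"
    have k: "int k = ?s - int r"
      using \<open>int r \<le> ?s\<close> by (simp add: k_def)
    have "empty_on \<omega> ({a - 1..a - 1 + int k + int r} - {a - 1})"
      using \<omega>(2) k by (auto simp: empty_on_def)
    then obtain \<zeta> where \<zeta>: "half_line_steps (a - 1) \<omega> \<zeta>"
        "empty_on \<zeta> ({a - 1..a - 1 + int k + int r} - {a - 1 + int k})"
      using push_particle_right[OF R] by blast
    have "half_line_steps (a - 1) \<eta> \<zeta>"
      using steps \<zeta>(1) by simp
    moreover have "empty_on \<zeta> {a - 1..<a - 1 + sum (weight \<eta>) {a - 1..b}}"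
      using \<zeta>(2) k sum True by (auto simp: empty_on_def weight_def)
    ultimately show ?thesis by blast
  qed
qed

text \<open>Stop at the first length whose weight reaches \<open>r\<close>. Shorter prefixes weigh
  less than \<open>r\<close>, so every suffix has positive weight, as draining demands.\<close>

lemma exch_origin_connected_if_weight:
  assumes R: "c (- 1) 0 (filled_on {..- 1}) \<noteq> 0"
    and "int r \<le> sum (weight \<eta>) {2..1 + int n}"
  shows "connected_configs c \<eta> (exch 0 1 \<eta>)"
proof -
  define S where "S n = sum (weight \<eta>) {2..1 + int n}" for n :: nat
  define m where "m = (LEAST n. int r \<le> S n)"
  have m: "int r \<le> S m"
    unfolding m_def by (rule LeastI[of _ n]) (use assms in \<open>simp add: S_def\<close>)
  have less: "S j < int r" if "j < m" for j
    using not_less_Least[of j "\<lambda>n. int r \<le> S n"] that unfolding m_def by simp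
  have "0 \<le> sum (weight \<eta>) {k..1 + int m}" if "2 \<le> k" "k \<le> 1 + int m" for k
  proof -
    have "sum (weight \<eta>) ({2..k - 1} \<union> {k..1 + int m})
        = sum (weight \<eta>) {2..k - 1} + sum (weight \<eta>) {k..1 + int m}"
      by (rule sum.union_disjoint) auto
    moreover have "{2..k - 1} \<union> {k..1 + int m} = {2..1 + int m}"
      using that by auto
    moreover have "1 + int (nat (k - 2)) = k - 1"
      using that by simp
    ultimately have "S m = S (nat (k - 2)) + sum (weight \<eta>) {k..1 + int m}"
      by (simp add: S_def)
    moreover have "nat (k - 2) < m"
      using that by linarith
    ultimately show ?thesis
      using m less[of "nat (k - 2)"] by linarith
  qed
  then obtain \<omega> where "half_line_steps 2 \<eta> \<omega>" "empty_on \<omega> {2..<2 + S m}"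
    using drain[OF R, of 2 "1 + int m" \<eta>] by (auto simp: S_def)
  then show ?thesis
    using m by (intro exch_origin_connected[OF R, of _ \<omega>]) (auto simp: empty_on_def)
qed

section \<open>Mobile clusters\<close>

text \<open>
  In an interval of \<open>2 r + 1\<close> sites that is empty except possibly at one site, every bond adjacent
  to that site has \<open>r\<close> vacancies on one of its sides.
\<close>

lemma half_line_step_two_sided:
  assumes "c (- 1) 0 (filled_on {..- 1}) \<noteq> 0" and "c (- 1) 0 (filled_on {0..}) \<noteq> 0"
    and "empty_on \<eta> ({a..a + 2 * int r} - {x, x + 1})" and "a \<le> x" "x < a + 2 * int r"
  shows "half_line_step a \<eta> (exch x (x + 1) \<eta>)"
proof (cases "x + 1 + int r \<le> a + 2 * int r")
  case True
  then show ?thesis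
    using assms by (intro half_line_step_right) (auto simp: empty_on_def)
next
  case False
  then show ?thesis
    using assms by (intro half_line_step_left) (auto simp: empty_on_def)
qed

text \<open>The one site of unrestricted value crosses the interval one bond at a time, in either
  direction, using only moves in \<open>[a, \<infinity>)\<close>.\<close>

lemma move_site:
  assumes c: "c (- 1) 0 (filled_on {..- 1}) \<noteq> 0" "c (- 1) 0 (filled_on {0..}) \<noteq> 0"
    and "k \<le> 2 * r"
  shows "empty_on \<eta> ({a..a + 2 * int r} - {a}) \<Longrightarrow>
      \<exists>\<omega>. half_line_steps a \<eta> \<omega> \<and> empty_on \<omega> ({a..a + 2 * int r} - {a + int k})"
    and "empty_on \<eta> ({a..a + 2 * int r} - {a + int k}) \<Longrightarrow>
      \<exists>\<omega>. half_line_steps a \<eta> \<omega> \<and> empty_on \<omega> ({a..a + 2 * int r} - {a})"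
  using assms(3)
proof (induction k arbitrary: \<eta>)
  case 0
  {
    case 1
    then show ?case by auto
  next
    case 2
    then show ?case by auto
  }
next
  case (Suc k)
  {
    case 1
    then obtain \<omega> where \<omega>: "half_line_steps a \<eta> \<omega>" "empty_on \<omega> ({a..a + 2 * int r} - {a + int k})"
      using Suc.IH(1)[of \<eta>] by auto
    let ?\<zeta> = "exch (a + int k) (a + int k + 1) \<omega>"
    have "half_line_step a \<omega> ?\<zeta>"
      by (rule half_line_step_two_sided[OF c]) (use 1 \<omega>(2) in \<open>auto simp: empty_on_def\<close>)
    moreover have "empty_on ?\<zeta> ({a..a + 2 * int r} - {a + int (Suc k)})"
      using \<omega>(2) 1 by (auto simp: empty_on_def exch_def)
    ultimately show ?case
      using \<omega>(1) by (meson rtranclp.rtrancl_into_rtrancl)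
  next
    case 2
    let ?\<zeta> = "exch (a + int k) (a + int k + 1) \<eta>"
    have step: "half_line_step a \<eta> ?\<zeta>"
      by (rule half_line_step_two_sided[OF c]) (use 2 in \<open>auto simp: empty_on_def\<close>)
    have "empty_on ?\<zeta> ({a..a + 2 * int r} - {a + int k})"
      using 2 by (auto simp: empty_on_def exch_def)
    then obtain \<omega> where "half_line_steps a ?\<zeta> \<omega>" "empty_on \<omega> ({a..a + 2 * int r} - {a})"
      using Suc.IH(2)[of ?\<zeta>] 2 by auto
    then show ?case
      using step by (meson converse_rtranclp_into_rtranclp)
  }
qed

text \<open>Carrying the value of an adjacent site across the \<open>2 * r\<close> vacancies to the
  other end shifts the empty interval by one.\<close>

lemma mobile_cluster_interval:
  assumes c: "c (- 1) 0 (filled_on {..- 1}) \<noteq> 0" "c (- 1) 0 (filled_on {0..}) \<noteq> 0"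
  shows "mobile_cluster c {0..2 * int r - 1}"
  unfolding mobile_cluster_def
proof (intro conjI allI ballI impI)
  fix a s :: int and \<eta> :: config
  assume s: "s \<in> {1, - 1}" and "empty_on \<eta> ((+) a ` {0..2 * int r - 1})"
  then have e: "empty_on \<eta> {a..a + 2 * int r - 1}"
    by (simp add: algebra_simps)
  have "\<exists>\<omega>. connected_configs c \<eta> \<omega> \<and> empty_on \<omega> {a + s..a + s + 2 * int r - 1}"
  proof (cases "s = 1")
    case True
    have "empty_on \<eta> ({a..a + 2 * int r} - {a + int (2 * r)})"
      using e by (auto simp: empty_on_def)
    then obtain \<omega> where "half_line_steps a \<eta> \<omega>" "empty_on \<omega> ({a..a + 2 * int r} - {a})"
      using move_site(2)[OF c, of "2 * r" \<eta> a] by auto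
    then show ?thesis
      using True half_line_steps_connected by (intro exI[of _ \<omega>]) (auto simp: empty_on_def)
  next
    case False
    then have "s = - 1" using s by simp
    have "empty_on \<eta> ({a - 1..a - 1 + 2 * int r} - {a - 1})"
      using e by (auto simp: empty_on_def)
    then obtain \<omega> where "half_line_steps (a - 1) \<eta> \<omega>"
        "empty_on \<omega> ({a - 1..a - 1 + 2 * int r} - {a - 1 + int (2 * r)})"
      using move_site(1)[OF c, of "2 * r" \<eta> "a - 1"] by auto
    then show ?thesis
      using \<open>s = - 1\<close> half_line_steps_connected by (intro exI[of _ \<omega>]) (auto simp: empty_on_def)
  qed
  then show "\<exists>\<eta>'. connected_configs c \<eta>' \<eta> \<and> empty_on \<eta>' ((+) (a + s) ` {0..2 * int r - 1})"
    using connected_sym by (auto simp: algebra_simps)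
qed (use r_pos in auto)

text \<open>The empty interval walks left by moves inside \<open>[2, \<infinity>)\<close> until it
  starts at site 2, where it enables the bond \<open>(0, 1)\<close>.\<close>

lemma exch_origin_connected_if_cluster:
  assumes c: "c (- 1) 0 (filled_on {..- 1}) \<noteq> 0" "c (- 1) 0 (filled_on {0..}) \<noteq> 0"
    and "empty_on \<eta> {2 + int n..<2 + int n + 2 * int r}"
  shows "connected_configs c \<eta> (exch 0 1 \<eta>)"
proof -
  have "\<exists>\<omega>. half_line_steps 2 \<eta> \<omega> \<and> empty_on \<omega> {2..<2 + 2 * int r}"
    using assms(3)
  proof (induction n arbitrary: \<eta>)
    case 0
    then show ?case by auto
  next
    case (Suc n)
    let ?a = "2 + int n"
    have "empty_on \<eta> ({?a..?a + 2 * int r} - {?a})"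
      using Suc.prems by (auto simp: empty_on_def)
    then obtain \<omega> where \<omega>: "half_line_steps ?a \<eta> \<omega>"
        "empty_on \<omega> ({?a..?a + 2 * int r} - {?a + int (2 * r)})"
      using move_site(1)[OF c, of "2 * r" \<eta> ?a] by auto
    then have "empty_on \<omega> {?a..<?a + 2 * int r}"
      by (auto simp: empty_on_def)
    then obtain \<zeta> where "half_line_steps 2 \<omega> \<zeta>" "empty_on \<zeta> {2..<2 + 2 * int r}"
      using Suc.IH by blast
    moreover have "half_line_steps 2 \<eta> \<omega>"
      using half_line_steps_mono[OF _ \<omega>(1)] by simp
    ultimately show ?case
      by (meson rtranclp_trans)
  qed
  then show ?thesis
    using exch_origin_connected[OF c(1)] r_pos by (force simp: empty_on_def)
qed

section \<open>Invariants\<close>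

text \<open>Only the bonds \<open>(0, 1)\<close> and \<open>(1 + r, 2 + r)\<close> could break the
  block. Each is blocked by the \<open>r\<close> particles of the block other than its own endpoint,
  which is why the block has \<open>r + 1\<close> sites.\<close>

lemma filled_block_invariant:
  assumes "c (- 1) 0 (filled_on {..- 1}) = 0" and "c (- 1) 0 (filled_on {0..}) = 0"
    and "connected_configs c \<eta> \<omega>" and "\<And>z. z \<in> {1..1 + int r} \<Longrightarrow> \<eta> z" and "z \<in> {1..1 + int r}"
  shows "\<omega> z"
proof -
  define P where "P \<zeta> \<longleftrightarrow> (\<forall>z\<in>{1..1 + int r}. \<zeta> z)" for \<zeta> :: config
  have "P \<omega>"
    using assms(3)
  proof (rule connected_invariant[where P = P])
    fix x \<zeta>
    assume P: "P \<zeta>" and c: "c x (x + 1) \<zeta> \<noteq> 0"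
    have "x \<noteq> 0"
      using blocked_right[OF assms(2), of x \<zeta>] P c by (auto simp: P_def)
    moreover have "x \<noteq> 1 + int r"
      using blocked_left[OF assms(1), of x \<zeta>] P c by (auto simp: P_def)
    ultimately show "P (exch x (x + 1) \<zeta>)"
      using P by (auto simp: P_def exch_def)
  qed (use assms(4) in \<open>auto simp: P_def\<close>)
  then show ?thesis using assms(5) by (simp add: P_def)
qed

definition vacancies :: "config \<Rightarrow> int \<Rightarrow> int set" where
  "vacancies \<eta> n = {i \<in> {1..n}. \<not> \<eta> i}"

text \<open>
  In other words, the \<open>j\<close>-th vacancy to the right of the origin stays to the right of \<open>(r + 1) j\<close>:
  it can only move when the next one is at distance at most \<open>r + 1\<close>.
\<close>

lemma sparse_vacancies_invariant:
  assumes R: "c (- 1) 0 (filled_on {0..}) = 0"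
    and "connected_configs c \<eta> \<omega>"
    and "\<And>n. 1 \<le> n \<Longrightarrow> int (Suc r * card (vacancies \<eta> n)) < n" and "1 \<le> n"
  shows "int (Suc r * card (vacancies \<omega> n)) < n"
proof -
  define P where "P \<zeta> \<longleftrightarrow> (\<forall>n\<ge>1. int (Suc r * card (vacancies \<zeta> n)) < n)" for \<zeta> :: config
  have fin: "finite (vacancies \<zeta> n)" for \<zeta> n
    by (auto simp: vacancies_def intro: finite_subset[of _ "{1..n}"])
  have "P \<omega>"
    using assms(2)
  proof (rule connected_invariant[where P = P])
    fix x \<zeta>
    assume P: "P \<zeta>" and "c x (x + 1) \<zeta> \<noteq> 0"
    then obtain z where z: "x + 2 \<le> z" "z \<le> x + 1 + int r" "\<not> \<zeta> z"
      using blocked_right[OF R] by blast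
    let ?\<xi> = "exch x (x + 1) \<zeta>"
    show "P ?\<xi>"
      unfolding P_def
    proof (intro allI impI)
      fix n :: int
      assume "1 \<le> n"
      \<comment> \<open>The bond \<open>(0, 1)\<close> is never enabled: a vacancy at
        \<open>z \<le> 1 + int r\<close> would already violate the bound at
        \<open>n = z\<close>.\<close>
      have x: "1 \<le> x" if "x \<ge> 0"
      proof (rule ccontr)
        assume "\<not> 1 \<le> x"
        then have "x = 0" using that by simp
        then have "z \<in> vacancies \<zeta> z"
          using z by (auto simp: vacancies_def)
        then have "1 \<le> card (vacancies \<zeta> z)"
          using fin by (metis One_nat_def Suc_leI card_gt_0_iff empty_iff)
        then have "int (Suc r * 1) \<le> int (Suc r * card (vacancies \<zeta> z))"
          by (intro of_nat_mono mult_le_mono2)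
        also have "int (Suc r * card (vacancies \<zeta> z)) < z"
          using P z \<open>x = 0\<close> by (auto simp: P_def)
        finally show False
          using z \<open>x = 0\<close> by simp
      qed
      \<comment> \<open>Only the count at \<open>n = x\<close> can change: for other
        \<open>n\<close> the interval \<open>{1..n}\<close> contains both exchanged sites or
        neither.\<close>
      consider "x < 0 \<or> n < x" | "1 \<le> x" "n = x" | "1 \<le> x" "x < n"
        using x by linarith
      then show "int (Suc r * card (vacancies ?\<xi> n)) < n"
      proof cases
        case 1
        then have "vacancies ?\<xi> n = vacancies \<zeta> n"
          by (auto simp: vacancies_def exch_def)
        then show ?thesis using P \<open>1 \<le> n\<close> by (simp add: P_def)
      next
        case 2
        \<comment> \<open>The new count on \<open>{1..x}\<close> is at most the old one on
          \<open>{1..x + 1}\<close>, and \<open>z\<close> adds one more vacancy. Having room for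
          that one below \<open>z \<le> x + 1 + int r\<close> costs \<open>r + 1\<close>, which
          leaves the bound at \<open>x\<close>.\<close>
        let ?f = "\<lambda>i. if i = x then (if \<zeta> x then x + 1 else x) else i"
        have "card (vacancies ?\<xi> x) \<le> card (vacancies \<zeta> (x + 1))"
          by (rule card_inj_on_le[of ?f])
            (use 2 fin[of \<zeta> "x + 1"] in \<open>auto simp: vacancies_def exch_def inj_on_def split: if_splits\<close>)
        moreover have "insert z (vacancies \<zeta> (x + 1)) \<subseteq> vacancies \<zeta> z"
          using z 2 by (auto simp: vacancies_def)
        then have "card (insert z (vacancies \<zeta> (x + 1))) \<le> card (vacancies \<zeta> z)"
          using fin card_mono by blast
        then have "Suc (card (vacancies \<zeta> (x + 1))) \<le> card (vacancies \<zeta> z)"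
          using z fin by (simp add: vacancies_def)
        ultimately have "Suc (card (vacancies ?\<xi> x)) \<le> card (vacancies \<zeta> z)"
          by linarith
        then have "int (Suc r * Suc (card (vacancies ?\<xi> x)))
            \<le> int (Suc r * card (vacancies \<zeta> z))"
          by (intro of_nat_mono mult_le_mono2)
        also have "int (Suc r * card (vacancies \<zeta> z)) < z"
          using P z 2 by (auto simp: P_def)
        finally show ?thesis
          using z 2 by (simp add: algebra_simps)
      next
        case 3
        let ?t = "\<lambda>i. if i = x then x + 1 else if i = x + 1 then x else i"
        have "bij_betw ?t (vacancies \<zeta> n) (vacancies ?\<xi> n)"
          by (rule bij_betwI[where g = ?t])
            (use 3 in \<open>auto simp: vacancies_def  exch_def\<close>)
        then have "card (vacancies ?\<xi> n) = card (vacancies \<zeta> n)"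
          by (simp add: bij_betw_same_card)
        then show ?thesis using P \<open>1 \<le> n\<close> by (simp add: P_def)
      qed
    qed
  qed (use assms(3) in \<open>auto simp: P_def\<close>)
  then show ?thesis using assms(4) by (simp add: P_def)
qed

end

section \<open>Cylinder probabilities\<close>

definition cylinder :: "int set \<Rightarrow> config \<Rightarrow> config set" where
  "cylinder J f = {\<eta>. \<forall>i\<in>J. \<eta> i = f i}"

lemma prob_space_site_measure: "prob_space (site_measure q)"
  unfolding site_measure_def by (intro prob_space_PiM prob_space_measure_pmf)

lemma space_site_measure [simp]: "space (site_measure q) = UNIV"
  by (simp add: site_measure_def space_PiM PiE_UNIV_domain)

lemma cylinder_eq_prod_emb:
  "cylinder J f = prod_emb UNIV (\<lambda>_. measure_pmf (bernoulli_pmf (1 - q))) J (PiE J (\<lambda>i. {f i}))"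
  by (subst prod_emb_PiE) (simp_all add: cylinder_def set_eq_iff PiE_UNIV_domain Pi_iff Ball_def)

lemma sets_cylinder [simp]: "finite J \<Longrightarrow> cylinder J f \<in> sets (site_measure q)"
  unfolding site_measure_def cylinder_eq_prod_emb[of J f q] by (rule sets_PiM_I) auto

lemma measure_cylinder:
  assumes "finite J"
  shows "measure (site_measure q) (cylinder J f) = (\<Prod>i\<in>J. pmf (bernoulli_pmf (1 - q)) (f i))"
proof -
  interpret product_prob_space "\<lambda>_::int. measure_pmf (bernoulli_pmf (1 - q))" UNIV
    by unfold_locales
  show ?thesis
    unfolding site_measure_def cylinder_eq_prod_emb[of J f q] using assms
    by (subst measure_PiM_emb) (simp_all add: measure_pmf_single)
qed

lemma measure_cylinder_pos:
  assumes "finite J" and "q \<in> {0<..<1}"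
  shows "0 < measure (site_measure q) (cylinder J f)"
proof -
  have "0 < pmf (bernoulli_pmf (1 - q)) b" for b
    using assms(2) by (cases b) auto
  then show ?thesis
    using assms by (simp add: measure_cylinder prod_pos)
qed

lemma (in prob_space) AE_notin_if_bounds_tendsto_0:
  assumes "N \<in> events" and "\<And>n. prob N \<le> u n" and "u \<longlonglongrightarrow> 0"
  shows "AE x in M. x \<notin> N"
proof -
  have "prob N \<le> 0"
    using assms(2,3) by (intro LIMSEQ_le_const) auto
  then have "prob N = 0"
    using measure_nonneg[of M N] by linarith
  then show ?thesis
    using assms(1) by (simp add: prob_eq_0)
qed

text \<open>
  A union bound over the at most \<open>2 ^ card F\<close> sets \<open>B\<close> of sites of value \<open>b\<close>. The constant \<open>8\<close>
  leaves a factor \<open>4\<close> per site in the applications, where \<open>k\<close> is about \<open>card F\<close>.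
\<close>

lemma measure_dense_sites_le:
  assumes "finite F" "finite D" "D \<inter> F = {}"
    and p: "pmf (bernoulli_pmf (1 - q)) b \<le> (1 / 8) ^ m"
  shows "measure (site_measure q) (\<Union>B\<in>{B. B \<subseteq> F \<and> k \<le> m * card B}. cylinder (D \<union> B) (\<lambda>_. b))
    \<le> pmf (bernoulli_pmf (1 - q)) b ^ card D * (2 ^ card F * (1 / 8) ^ k)"
proof -
  interpret prob_space "site_measure q" by (rule prob_space_site_measure)
  let ?p = "pmf (bernoulli_pmf (1 - q)) b"
  let ?I = "{B. B \<subseteq> F \<and> k \<le> m * card B}"
  have I: "?I \<subseteq> Pow F" by auto
  then have finI: "finite ?I"
    using assms(1) by (meson finite_Pow_iff finite_subset)
  have fin: "finite B" if "B \<in> ?I" for B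
    using that assms(1) by (auto intro: finite_subset)
  have each: "prob (cylinder (D \<union> B) (\<lambda>_. b)) \<le> ?p ^ card D * (1 / 8) ^ k" if B: "B \<in> ?I" for B
  proof -
    have "D \<inter> B = {}"
      using B assms(3) by auto
    then have "prob (cylinder (D \<union> B) (\<lambda>_. b)) = ?p ^ card D * ?p ^ card B"
      using fin[OF B] assms(2) by (simp add: measure_cylinder card_Un_disjoint power_add)
    \<comment> \<open>With \<open>k \<le> m * card B\<close> the bound per site becomes a bound with
      exponent \<open>k\<close>; the factor for \<open>D\<close> is kept exact.\<close>
    also have "?p ^ card B \<le> ((1 / 8) ^ m) ^ card B"
      by (rule power_mono) (use p in auto)
    also have "\<dots> \<le> (1 / 8) ^ k"
      unfolding power_mult[symmetric] using B by (intro power_decreasing) auto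
    finally show ?thesis
      by (simp add: mult_left_mono)
  qed
  have "prob (\<Union>B\<in>?I. cylinder (D \<union> B) (\<lambda>_. b)) \<le> (\<Sum>B\<in>?I. prob (cylinder (D \<union> B) (\<lambda>_. b)))"
  proof (rule finite_measure_subadditive_finite[OF finI])
    show "(\<lambda>B. cylinder (D \<union> B) (\<lambda>_. b)) ` ?I \<subseteq> events"
      by (intro image_subsetI sets_cylinder finite_UnI assms(2) fin)
  qed
  also have "\<dots> \<le> (\<Sum>B\<in>?I. ?p ^ card D * (1 / 8) ^ k)"
    by (rule sum_mono) (rule each)
  also have "\<dots> = real (card ?I) * (?p ^ card D * (1 / 8) ^ k)"
    by (simp only: sum_constant)
  also have "\<dots> \<le> real (2 ^ card F) * (?p ^ card D * (1 / 8) ^ k)"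
    using card_mono[OF _ I] assms(1) by (intro mult_right_mono of_nat_mono) (simp_all add: card_Pow)
  also have "\<dots> = ?p ^ card D * (2 ^ card F * (1 / 8) ^ k)"
    by simp
  finally show ?thesis .
qed

text \<open>Disjoint blocks are independent. The set \<open>K\<close> makes the induction close:
  intersecting with the cylinder of block \<open>n\<close> amounts to enlarging \<open>K\<close> by
  \<open>J n\<close>.\<close>

lemma measure_avoid_cylinders:
  fixes J :: "nat \<Rightarrow> int set"
  assumes "\<And>k. finite (J k)" "disjoint_family J" and "finite K" "\<And>k. K \<inter> J k = {}"
  shows "measure (site_measure q) (cylinder K f - (\<Union>k<n. cylinder (J k) f))
    = measure (site_measure q) (cylinder K f)
      * (\<Prod>k<n. 1 - measure (site_measure q) (cylinder (J k) f))"
proof -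
  interpret prob_space "site_measure q" by (rule prob_space_site_measure)
  define E where "E n K = cylinder K f - (\<Union>k<n. cylinder (J k) f)" for n :: nat and K
  have sets: "E n K \<in> sets (site_measure q)" if "finite K" for n K
    using that assms(1) unfolding E_def by (intro sets.Diff sets.finite_UN) auto
  have "prob (E n K) = prob (cylinder K f) * (\<Prod>k<n. 1 - prob (cylinder (J k) f))"
    if "finite K" "\<And>k. k < n \<Longrightarrow> K \<inter> J k = {}" for K
    using that
  proof (induction n arbitrary: K)
    case 0
    then show ?case by (simp add: E_def)
  next
    case (Suc n)
    have "(K \<union> J n) \<inter> J k = {}" if "k < n" for k
      using Suc.prems(2)[of k] that assms(2)
      by (auto simp: disjoint_family_on_def Int_Un_distrib2)
    then have *: "prob (E n (K \<union> J n))
        = prob (cylinder (K \<union> J n) f) * (\<Prod>k<n. 1 - prob (cylinder (J k) f))"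
      using Suc.prems(1) assms(1) by (intro Suc.IH) auto
    have "prob (cylinder (K \<union> J n) f) = prob (cylinder K f) * prob (cylinder (J n) f)"
      using Suc.prems assms(1) by (simp add: measure_cylinder prod.union_disjoint)
    moreover have Un: "cylinder (K \<union> J n) f = cylinder K f \<inter> cylinder (J n) f"
      by (auto simp: cylinder_def)
    have E_Un: "E n (K \<union> J n) \<subseteq> E n K"
      unfolding E_def Un by blast
    have "E (Suc n) K = E n K - E n (K \<union> J n)"
      unfolding E_def Un lessThan_Suc by blast
    then have "prob (E (Suc n) K) = prob (E n K) - prob (E n (K \<union> J n))"
      using sets Suc.prems(1) assms(1) by (simp add: finite_measure_Diff E_Un)
    ultimately show ?case
      using * Suc.IH[of K] Suc.prems by (simp add: algebra_simps)
  qed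
  then show ?thesis
    using assms by (simp add: E_def)
qed

text \<open>The blocks are independent and each is empty with probability \<open>q ^ l\<close>, so
  the first \<open>n\<close> all fail with probability \<open>(1 - q ^ l) ^ n\<close>, which tends
  to 0.\<close>

lemma AE_cylinder_occurs:
  fixes J :: "nat \<Rightarrow> int set"
  assumes "q \<in> {0<..<1}" and J: "\<And>k. finite (J k)" "disjoint_family J"
    and card: "\<And>k. card (J k) = l"
  shows "AE \<eta> in site_measure q. \<exists>k. empty_on \<eta> (J k)"
proof -
  interpret prob_space "site_measure q" by (rule prob_space_site_measure)
  let ?f = "\<lambda>_::int. False"
  define N where "N = UNIV - (\<Union>k. cylinder (J k) ?f)"
  have "AE \<eta> in site_measure q. \<eta> \<notin> N"
  proof (rule AE_notin_if_bounds_tendsto_0)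
    show "N \<in> sets (site_measure q)"
    proof -
      have "(\<Union>k. cylinder (J k) ?f) \<in> events"
        by (intro sets.countable_UN) (auto simp: J(1))
      then show ?thesis
        unfolding N_def
        using sets.top[of "site_measure q", unfolded space_site_measure] by (rule sets.Diff[rotated])
    qed
    show "prob N \<le> (1 - q ^ l) ^ n" for n
    proof -
      \<comment> \<open>\<open>cylinder {} ?f\<close> is the whole space, so the product formula
        applies with \<open>K = {}\<close>.\<close>
      have "prob N \<le> prob (cylinder {} ?f - (\<Union>k<n. cylinder (J k) ?f))"
      proof (rule finite_measure_mono)
        show "N \<subseteq> cylinder {} ?f - (\<Union>k<n. cylinder (J k) ?f)"
          unfolding N_def by (auto simp: cylinder_def[of "{}"])
        show "cylinder {} ?f - (\<Union>k<n. cylinder (J k) ?f) \<in> events"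
          using J(1) by (intro sets.Diff sets.finite_UN sets_cylinder) auto
      qed
      also have "\<dots> = (1 - q ^ l) ^ n"
        using J assms(1) card by (subst measure_avoid_cylinders) (auto simp: measure_cylinder)
      finally show ?thesis .
    qed
    have "0 < q ^ l" "q ^ l \<le> 1"
      using assms(1) by (auto simp: power_le_one)
    then show "(\<lambda>n. (1 - q ^ l) ^ n) \<longlonglongrightarrow> 0"
      by (intro LIMSEQ_realpow_zero) auto
  qed
  then show ?thesis
    by eventually_elim (auto simp: N_def cylinder_def empty_on_def)
qed

section \<open>Ergodicity\<close>

context kclg_range
begin

lemma ergodic_two_sided:
  assumes c: "c (- 1) 0 (filled_on {..- 1}) \<noteq> 0" "c (- 1) 0 (filled_on {0..}) \<noteq> 0"
    and "q \<in> {0<..<1}"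
  shows "ergodic_at c q"
proof -
  \<comment> \<open>Consecutive blocks of \<open>2 * r\<close> sites from site 2 on, each a
    candidate for the mobile interval.\<close>
  define J where "J k = {2 + int (2 * r * k)..<2 + int (2 * r * k) + 2 * int r}" for k :: nat
  have "J j \<inter> J k = {}" if "j < k" for j k
  proof -
    have "2 * r * Suc j \<le> 2 * r * k"
      using that by (intro mult_le_mono2) simp
    then have "int (2 * r * Suc j) \<le> int (2 * r * k)"
      by (rule of_nat_mono)
    then have "2 * int r + int (2 * r * j) \<le> int (2 * r * k)"
      by simp
    then show ?thesis
      unfolding J_def by auto
  qed
  then have "disjoint_family J"
    unfolding disjoint_family_on_def by (metis Int_commute linorder_neqE_nat)
  have "AE \<eta> in site_measure q. \<exists>k. empty_on \<eta> (J k)"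
    by (rule AE_cylinder_occurs[OF assms(3) _ \<open>disjoint_family J\<close>, where l = "2 * r"])
      (simp_all add: J_def)
  then show ?thesis
    unfolding ergodic_at_def
    by eventually_elim (auto simp only: J_def intro: exch_origin_connected_if_cluster[OF c])
qed

lemma not_ergodic_blocked:
  assumes c: "c (- 1) 0 (filled_on {..- 1}) = 0" "c (- 1) 0 (filled_on {0..}) = 0"
    and q: "q \<in> {0<..<1}"
  shows "\<not> ergodic_at c q"
proof
  interpret prob_space "site_measure q" by (rule prob_space_site_measure)
  \<comment> \<open>Site 0 is empty and the next \<open>r + 1\<close> sites are filled, so the
    exchange would put a vacancy into a block that never breaks.\<close>
  let ?A = "cylinder {0..1 + int r} (\<lambda>i. i \<noteq> 0)"
  assume "ergodic_at c q"
  then have "AE \<eta> in site_measure q. connected_configs c \<eta> (exch 0 1 \<eta>)"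
    by (simp add: ergodic_at_def)
  then have "AE \<eta> in site_measure q. \<eta> \<notin> ?A"
  proof eventually_elim
    case (elim \<eta>)
    show ?case
    proof
      assume "\<eta> \<in> ?A"
      then have "\<not> exch 0 1 \<eta> 1" and "\<And>z. z \<in> {1..1 + int r} \<Longrightarrow> \<eta> z"
        by (auto simp: exch_def cylinder_def)
      then show False
        using filled_block_invariant[OF c elim, of 1] by simp
    qed
  qed
  then have "prob ?A = 0"
    by (simp add: prob_eq_0)
  then show False
    using measure_cylinder_pos[OF _ q, of "{0..1 + int r}" "\<lambda>i. i \<noteq> 0"] by simp
qed

section \<open>One-sided models at high and at low vacancy density\<close>

lemma weight_sum:
  assumes "finite F"
  shows "sum (weight \<eta>) F = int (card F) - int (Suc r * card {i\<in>F. \<eta> i})"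
proof -
  have "sum (weight \<eta>) F = (\<Sum>i\<in>F. 1 - (if \<eta> i then int (Suc r) else 0))"
    by (rule sum.cong) (auto simp: weight_def)
  also have "\<dots> = int (card F) - int (Suc r) * int (card {i\<in>F. \<eta> i})"
    using assms by (simp add: sum_subtractf sum.If_cases Int_def)
  finally show ?thesis by (simp only: of_nat_mult)
qed

text \<open>If the walk never reaches \<open>r\<close>, then for every \<open>n\<close> the
  \<open>n\<close> sites from 2 on hold at least \<open>(n - r) / (r + 1)\<close> particles. For
  each \<open>n\<close> a union bound gives this probability at most
  \<open>8 ^ r * (1 / 4) ^ n\<close>, so the walk reaches \<open>r\<close> almost surely.\<close>

lemma ergodic_low_density:
  assumes R: "c (- 1) 0 (filled_on {..- 1}) \<noteq> 0"
  shows "ergodic_at c (1 - (1 / 8) ^ Suc r)"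
proof -
  define q :: real where "q = 1 - (1 / 8) ^ Suc r"
  interpret prob_space "site_measure q" by (rule prob_space_site_measure)
  define U where
    "U n = (\<Union>B\<in>{B. B \<subseteq> {2..1 + int n} \<and> n - r \<le> Suc r * card B}. cylinder B (\<lambda>_. True))" for n
  have fin: "finite {B. B \<subseteq> {2..1 + int n} \<and> n - r \<le> Suc r * card B}" for n
    by (rule finite_subset[of _ "Pow {2..1 + int n}"]) auto
  have U: "U n \<in> events" for n
    unfolding U_def using fin by (intro sets.finite_UN) (auto intro!: sets_cylinder intro: finite_subset)
  have p: "pmf (bernoulli_pmf (1 - q)) True = (1 / 8) ^ Suc r"
    using power_le_one[of "1 / 8 :: real" "Suc r"] by (simp add: q_def)
  have "AE \<eta> in site_measure q. \<eta> \<notin> (\<Inter>n. U n)"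
  proof (rule AE_notin_if_bounds_tendsto_0)
    show "(\<Inter>n. U n) \<in> events"
      using U by auto
    show "prob (\<Inter>n. U n) \<le> 8 ^ r * (1 / 4) ^ n" for n
    proof -
      have "prob (\<Inter>n. U n) \<le> prob (U n)"
        using U by (intro finite_measure_mono) auto
      also have "\<dots> \<le> 2 ^ n * (1 / 8) ^ (n - r)"
        using measure_dense_sites_le[of "{2..1 + int n}" "{}" q True "Suc r" "n - r"] p
        by (simp add: U_def)
      \<comment> \<open>Natural subtraction makes the exponent 0 when \<open>n < r\<close>; the
        bound then comes from \<open>8 ^ n \<le> 8 ^ r\<close>.\<close>
      also have "(1 / 8 :: real) ^ (n - r) \<le> 8 ^ r * (1 / 8) ^ n"
      proof (cases "r \<le> n")
        case True
        then show ?thesis by (simp add: power_diff field_simps)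
      next
        case False
        then have "(8 :: real) ^ n \<le> 8 ^ r" by (intro power_increasing) auto
        then show ?thesis using False by (simp add: field_simps)
      qed
      then have "2 ^ n * (1 / 8 :: real) ^ (n - r) \<le> 2 ^ n * (8 ^ r * (1 / 8) ^ n)"
        by (rule mult_left_mono) simp
      also have "\<dots> = 8 ^ r * (2 * (1 / 8)) ^ n"
        by (simp only: power_mult_distrib mult_ac)
      finally show ?thesis by simp
    qed
    have "(\<lambda>n. (1 / 4 :: real) ^ n) \<longlonglongrightarrow> 0"
      by (rule LIMSEQ_realpow_zero) auto
    then show "(\<lambda>n. 8 ^ r * (1 / 4 :: real) ^ n) \<longlonglongrightarrow> 0"
      by (rule tendsto_mult_right_zero)
  qed
  then show ?thesis
    unfolding ergodic_at_def q_def[symmetric]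
  proof eventually_elim
    case (elim \<eta>)
    then obtain n where n: "\<eta> \<notin> U n" by auto
    let ?B = "{i\<in>{2..1 + int n}. \<eta> i}"
    have "\<not> n - r \<le> Suc r * card ?B"
    proof
      assume le: "n - r \<le> Suc r * card ?B"
      have "\<eta> \<in> U n"
        unfolding U_def by (rule UN_I[of ?B]) (use le in \<open>auto simp: cylinder_def\<close>)
      then show False using n by simp
    qed
    then have "Suc r * card ?B + r < n"
      by linarith
    then have "int r \<le> sum (weight \<eta>) {2..1 + int n}"
      by (simp only: weight_sum finite_atLeastAtMost_int card_atLeastAtMost_int)
    then show ?case
      by (rule exch_origin_connected_if_weight[OF R])
  qed
qed

text \<open>When site 0 is empty, ergodicity would force some \<open>{1..n}\<close> to have too many
  vacancies, since otherwise the invariant keeps site 1 filled. A union bound gives both together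
  probability at most \<open>q / 3\<close>, less than the probability \<open>q\<close> that site 0
  is empty.\<close>

lemma not_ergodic_high_density:
  assumes R: "c (- 1) 0 (filled_on {0..}) = 0"
    and q: "0 < q" "q \<le> (1 / 8) ^ Suc r"
  shows "\<not> ergodic_at c q"
proof
  interpret prob_space "site_measure q" by (rule prob_space_site_measure)
  let ?f = "\<lambda>_::int. False"
  let ?A = "cylinder {0} ?f"
  \<comment> \<open>Site 0 is part of the event so that its probability carries a factor
    \<open>q\<close>. Index \<open>n\<close> stands for length \<open>n + 1\<close>, the shortest
    interval being \<open>{1}\<close>.\<close>
  define U where "U n = (\<Union>B\<in>{B. B \<subseteq> {1..int (Suc n)} \<and> Suc n \<le> Suc r * card B}.
    cylinder ({0} \<union> B) ?f)" for n
  have fin: "finite {B. B \<subseteq> {1..int (Suc n)} \<and> Suc n \<le> Suc r * card B}" for n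
    by (rule finite_subset[of _ "Pow {1..int (Suc n)}"]) auto
  have U: "U n \<in> events" for n
    unfolding U_def using fin by (intro sets.finite_UN) (auto intro!: sets_cylinder intro: finite_subset)
  have "q \<le> 1"
    using q(2) power_le_one[of "1 / 8 :: real" "Suc r"] by simp
  then have p: "pmf (bernoulli_pmf (1 - q)) False = q"
    using q by simp
  have card: "card {1..int (Suc n)} = Suc n" for n
    by simp
  have "prob (U n) \<le> q * (2 ^ Suc n * (1 / 8) ^ Suc n)" for n
    using measure_dense_sites_le[of "{1..int (Suc n)}" "{0}" q False "Suc r" "Suc n"] q
    unfolding p card U_def by simp
  also have "q * (2 ^ Suc n * (1 / 8) ^ Suc n) = q / 4 * (1 / 4) ^ n" for n
    by (simp only: power_mult_distrib[symmetric]) simp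
  finally have bound: "prob (U n) \<le> q / 4 * (1 / 4) ^ n" for n .
  have sums: "(\<lambda>n. q / 4 * (1 / 4) ^ n) sums (q / 4 * (1 / (1 - 1 / 4)))"
    by (intro sums_mult geometric_sums) simp
  have summable: "summable (\<lambda>n. prob (U n))"
    by (rule summable_comparison_test'[OF sums_summable[OF sums]]) (use bound in auto)
  assume "ergodic_at c q"
  then have "AE \<eta> in site_measure q. connected_configs c \<eta> (exch 0 1 \<eta>)"
    by (simp add: ergodic_at_def)
  then have "AE \<eta> in site_measure q. \<eta> \<in> ?A \<longrightarrow> \<eta> \<in> (\<Union>n. U n)"
  proof eventually_elim
    case (elim \<eta>)
    show ?case
    proof (rule impI, rule ccontr)
      assume A: "\<eta> \<in> ?A" and notin: "\<eta> \<notin> (\<Union>n. U n)"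
      have "int (Suc r * card (vacancies \<eta> n)) < n" if "1 \<le> n" for n
      proof -
        define j where "j = nat (n - 1)"
        have j: "n = int (Suc j)"
          using that by (simp add: j_def)
        have mem: "\<eta> \<in> cylinder ({0} \<union> vacancies \<eta> n) ?f"
          using A by (auto simp: cylinder_def vacancies_def)
        have sub: "vacancies \<eta> n \<subseteq> {1..int (Suc j)}"
          using j by (auto simp: vacancies_def)
        have "\<not> Suc j \<le> Suc r * card (vacancies \<eta> n)"
        proof
          assume le: "Suc j \<le> Suc r * card (vacancies \<eta> n)"
          have "\<eta> \<in> U j"
            unfolding U_def by (rule UN_I[of "vacancies \<eta> n"]) (use mem le sub in simp_all)
          then show False using notin by auto
        qed
        then show ?thesis
          unfolding j by (simp only: of_nat_less_iff not_le)
      qed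
      then have "int (Suc r * card (vacancies (exch 0 1 \<eta>) 1)) < 1"
        by (rule sparse_vacancies_invariant[OF R elim]) simp_all
      moreover have "vacancies (exch 0 1 \<eta>) 1 = {1}"
        using A by (auto simp: vacancies_def exch_def cylinder_def)
      ultimately show False by simp
    qed
  qed
  then have "prob ?A \<le> prob (\<Union>n. U n)"
    using U by (intro finite_measure_mono_AE) auto
  also have "\<dots> \<le> (\<Sum>n. prob (U n))"
    using U summable by (intro finite_measure_subadditive_countably) auto
  also have "\<dots> \<le> q / 4 * (1 / (1 - 1 / 4))"
    using suminf_le[OF bound summable sums_summable[OF sums]] sums_unique[OF sums] by simp
  finally show False
    using q p by (simp add: measure_cylinder)
qed

end

section \<open>Reflection\<close>

text \<open>The centre is chosen so that sites 0 and 1, the bond in the definition of ergodicity,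
  are swapped.\<close>

definition reflect :: "config \<Rightarrow> config" where
  "reflect \<eta> = (\<lambda>z. \<eta> (1 - z))"

definition reflect_constraint ::
    "(int \<Rightarrow> int \<Rightarrow> config \<Rightarrow> real) \<Rightarrow> int \<Rightarrow> int \<Rightarrow> config \<Rightarrow> real" where
  "reflect_constraint c = (\<lambda>x y \<eta>. c (1 - x) (1 - y) (reflect \<eta>))"

lemma reflect_reflect [simp]: "reflect (reflect \<eta>) = \<eta>"
  by (simp add: reflect_def)

lemma reflect_constraint_twice [simp]: "reflect_constraint (reflect_constraint c) = c"
  by (simp add: reflect_constraint_def)

lemma reflect_exch: "reflect (exch x y \<eta>) = exch (1 - x) (1 - y) (reflect \<eta>)"
  by (auto simp: reflect_def exch_def fun_eq_iff)

lemma kclg_reflect_constraint: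
  assumes "kclg c"
  shows "kclg (reflect_constraint c)"
proof -
  interpret kclg c by fact
  show ?thesis
  proof
    show "reflect_constraint c x y \<eta> \<ge> 0" for x y \<eta>
      by (simp add: reflect_constraint_def nonneg)
    show "reflect_constraint c x y \<eta> = 0" if "\<bar>x - y\<bar> \<noteq> 1" for x y \<eta>
      using that by (simp add: reflect_constraint_def nearest_neighbour)
    show "reflect_constraint c x y \<eta> = reflect_constraint c y x \<eta>" for x y \<eta>
      by (simp add: reflect_constraint_def symmetric)
    show "reflect_constraint c x y \<eta> = reflect_constraint c (x + z) (y + z) (shift z \<eta>)" for x y z \<eta>
    proof -
      have "c (1 - x) (1 - y) (reflect \<eta>)
          = c (1 - x + (- z)) (1 - y + (- z)) (shift (- z) (reflect \<eta>))"
        by (rule translation_invariant)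
      also have "shift (- z) (reflect \<eta>) = reflect (shift z \<eta>)"
        by (simp add: shift_def reflect_def algebra_simps)
      finally show ?thesis
        by (simp add: reflect_constraint_def algebra_simps)
    qed
    show "reflect_constraint c x y \<eta> = reflect_constraint c x y \<omega>"
      if "\<And>z. z \<noteq> x \<Longrightarrow> z \<noteq> y \<Longrightarrow> \<eta> z = \<omega> z" for x y \<eta> \<omega>
      unfolding reflect_constraint_def
      by (rule independent_of_endpoints) (auto simp: reflect_def intro!: that)
    obtain r where "r > 0"
      and r: "\<And>x y \<eta> \<omega>. \<forall>z\<in>{x - r..x + r}. \<eta> z = \<omega> z \<Longrightarrow> c x y \<eta> = c x y \<omega>"
      using finite_range by blast
    moreover have "reflect_constraint c x y \<eta> = reflect_constraint c x y \<omega>"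
      if "\<forall>z\<in>{x - r..x + r}. \<eta> z = \<omega> z" for x y \<eta> \<omega>
      unfolding reflect_constraint_def by (rule r) (use that in \<open>auto simp: reflect_def\<close>)
    ultimately show "\<exists>r>0. \<forall>x y \<eta> \<omega>. (\<forall>z\<in>{x - r..x + r}. \<eta> z = \<omega> z) \<longrightarrow>
        reflect_constraint c x y \<eta> = reflect_constraint c x y \<omega>"
      by blast
    show "reflect_constraint c x y \<eta> \<ge> reflect_constraint c x y \<omega>" if "\<eta> \<le> \<omega>" for x y \<eta> \<omega>
      unfolding reflect_constraint_def
      by (rule monotone) (use that in \<open>auto simp: reflect_def le_fun_def\<close>)
  qed
qed

text \<open>Reflection takes the bond \<open>(- 1, 0)\<close> to \<open>(2, 1)\<close> and the
  half-lines \<open>{..- 1}\<close> and \<open>{0..}\<close> to \<open>{2..}\<close> and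
  \<open>{..1}\<close>; translating back by 2 interchanges the original half-lines.\<close>

lemma reflect_constraint_filled_on:
  assumes "kclg c"
  shows "reflect_constraint c (- 1) 0 (filled_on {..- 1}) = c (- 1) 0 (filled_on {0..})"
    and "reflect_constraint c (- 1) 0 (filled_on {0..}) = c (- 1) 0 (filled_on {..- 1})"
proof -
  interpret kclg c by fact
  have "c 2 1 \<eta> = c (- 1) 0 (\<lambda>z. \<eta> (z + 2))" for \<eta>
    using c_shift_origin[of 1 \<eta>] symmetric[of 2 1 \<eta>] by (simp add: add.assoc)
  then show "reflect_constraint c (- 1) 0 (filled_on {..- 1}) = c (- 1) 0 (filled_on {0..})"
    and "reflect_constraint c (- 1) 0 (filled_on {0..}) = c (- 1) 0 (filled_on {..- 1})"
    by (auto simp: reflect_constraint_def reflect_def filled_on_def intro!: arg_cong[of _ _ "c (- 1) 0"])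
qed

lemma connected_reflect:
  "connected_configs c \<eta> \<omega> \<Longrightarrow> connected_configs (reflect_constraint c) (reflect \<eta>) (reflect \<omega>)"
  unfolding connected_configs_def
proof (induction rule: rtranclp_induct)
  case (step \<omega> \<zeta>)
  then obtain x y where "c x y \<omega> \<noteq> 0" "\<zeta> = exch x y \<omega>" by blast
  then have "reflect_constraint c (1 - x) (1 - y) (reflect \<omega>) \<noteq> 0
      \<and> reflect \<zeta> = exch (1 - x) (1 - y) (reflect \<omega>)"
    by (simp add: reflect_constraint_def reflect_exch)
  then show ?case
    using step.IH by (blast intro: rtranclp.rtrancl_into_rtrancl)
qed simp

lemma distr_reflect: "distr (site_measure q) (site_measure q) reflect = site_measure q"
  using distr_PiM_reindex[of UNIV "\<lambda>_. measure_pmf (bernoulli_pmf (1 - q))" "\<lambda>z::int. 1 - z" UNIV]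
  by (simp add: site_measure_def reflect_def[abs_def] prob_space_measure_pmf inj_on_def
      restrict_UNIV)

lemma measurable_reflect: "reflect \<in> measurable (site_measure q) (site_measure q)"
  unfolding site_measure_def reflect_def[abs_def] by (rule measurable_PiM_single') (auto simp: space_PiM)

text \<open>The site measure is invariant under reflection, moves reflect to moves for the reflected
  rates, and the exchange of 0 and 1 is its own mirror image.\<close>

lemma ergodic_at_reflect:
  assumes "ergodic_at c q"
  shows "ergodic_at (reflect_constraint c) q"
proof -
  have "AE \<eta> in distr (site_measure q) (site_measure q) reflect. connected_configs c \<eta> (exch 0 1 \<eta>)"
    using assms unfolding distr_reflect ergodic_at_def .
  then have "AE \<eta> in site_measure q. connected_configs c (reflect \<eta>) (exch 0 1 (reflect \<eta>))"
    by (rule AE_distrD[OF measurable_reflect])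
  then show ?thesis
    unfolding ergodic_at_def
  proof eventually_elim
    case (elim \<eta>)
    have "exch 1 0 \<eta> = exch 0 1 \<eta>"
      by (auto simp: exch_def fun_eq_iff)
    then show ?case
      using connected_reflect[OF elim] by (simp add: reflect_exch)
  qed
qed

lemma critical_parameter_reflect:
  "critical_parameter (reflect_constraint c) = critical_parameter c"
proof -
  have "ergodic_at (reflect_constraint c) q \<longleftrightarrow> ergodic_at c q" for q
    using ergodic_at_reflect[of c q] ergodic_at_reflect[of "reflect_constraint c" q] by auto
  then show ?thesis
    by (simp add: critical_parameter_def)
qed

section \<open>The critical parameter\<close>

text \<open>With \<open>\<delta> = (1 / 8) ^ Suc r\<close>, ergodicity holds at
  \<open>1 - \<delta>\<close> and fails at all positive parameters up to \<open>\<delta>\<close>, so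
  the infimum lies between the two.\<close>

lemma critical_parameter_one_sided:
  assumes "kclg c" "c (- 1) 0 (filled_on {..- 1}) \<noteq> 0" "c (- 1) 0 (filled_on {0..}) = 0"
  shows "0 < critical_parameter c \<and> critical_parameter c < 1"
proof -
  interpret kclg c by fact
  obtain r where "kclg_range c r"
    using kclg_range_exists by blast
  then interpret kclg_range c r .
  define \<delta> :: real where "\<delta> = (1 / 8) ^ Suc r"
  have \<delta>: "0 < \<delta>" "\<delta> < 1"
    unfolding \<delta>_def by (simp, intro power_Suc_less_one) auto
  let ?E = "{q \<in> {0<..<1}. ergodic_at c q}"
  have "1 - \<delta> \<in> ?E"
    using \<delta> ergodic_low_density[OF assms(2)] by (simp add: \<delta>_def)
  moreover have "\<delta> \<le> q" if "q \<in> ?E" for q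
    using that not_ergodic_high_density[OF assms(3), of q] unfolding \<delta>_def by fastforce
  ultimately have "?E \<noteq> {}" "\<delta> \<le> Inf ?E" "Inf ?E \<le> 1 - \<delta>"
    by (blast, intro cInf_greatest, blast, blast, intro cInf_lower bdd_belowI[of _ 0], auto)
  then show ?thesis
    using \<delta> unfolding critical_parameter_def Let_def by auto
qed

theorem theorem2p4:
  fixes c :: "int \<Rightarrow> int \<Rightarrow> config \<Rightarrow> real"
  assumes "kclg c"
  shows "(c (-1) 0 (filled_on {..-1}) \<noteq> 0 \<and> c (-1) 0 (filled_on {0..}) \<noteq> 0
            \<longrightarrow> critical_parameter c = 0 \<and> noncooperative c)
       \<and> (c (-1) 0 (filled_on {..-1}) = 0 \<and> c (-1) 0 (filled_on {0..}) = 0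
            \<longrightarrow> critical_parameter c = 1)
       \<and> ((c (-1) 0 (filled_on {..-1}) \<noteq> 0) \<noteq> (c (-1) 0 (filled_on {0..}) \<noteq> 0)
            \<longrightarrow> 0 < critical_parameter c \<and> critical_parameter c < 1)"
proof -
  interpret kclg c by fact
  obtain r where "kclg_range c r"
    using kclg_range_exists by blast
  then interpret kclg_range c r .
  have two_sided: "critical_parameter c = 0 \<and> noncooperative c"
    if "c (- 1) 0 (filled_on {..- 1}) \<noteq> 0" "c (- 1) 0 (filled_on {0..}) \<noteq> 0"
  proof
    have "{q \<in> {0<..<1}. ergodic_at c q} = {0<..<1::real}"
      using ergodic_two_sided[OF that] by auto
    then show "critical_parameter c = 0"
      by (simp add: critical_parameter_def)
    show "noncooperative c"
      unfolding noncooperative_def using mobile_cluster_interval[OF that] by blast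
  qed
  have blocked: "critical_parameter c = 1"
    if "c (- 1) 0 (filled_on {..- 1}) = 0" "c (- 1) 0 (filled_on {0..}) = 0"
  proof -
    have "{q \<in> {0<..<1}. ergodic_at c q} = {}"
      using not_ergodic_blocked[OF that] by auto
    then show ?thesis
      by (simp add: critical_parameter_def)
  qed
  \<comment> \<open>The other one-sided case is the mirror image of
    \<open>critical_parameter_one_sided\<close>.\<close>
  have "0 < critical_parameter c \<and> critical_parameter c < 1"
    if "c (- 1) 0 (filled_on {..- 1}) = 0" "c (- 1) 0 (filled_on {0..}) \<noteq> 0"
    using critical_parameter_one_sided[OF kclg_reflect_constraint[OF assms]] that
    by (simp add: reflect_constraint_filled_on[OF assms] critical_parameter_reflect)
  then show ?thesis
    using two_sided blocked critical_parameter_one_sided[OF assms] by blast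
qed

end
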